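(* Let $m\geq 2$ be an integer and let $\mathbf{q}=(q_1,\dots,q_m)\in[1,2]^m$ satisfy $$\frac{1}{q_1}+\cdots+\frac{1}{q_m}=\frac{m+1}{2}.$$ Then there is a finite constant $C$ such that $$\left(\sum_{j_1=1}^{n}\left(\sum_{j_2=1}^{n}\left(\cdots\left(\sum_{j_m=1}^{n}\left|T(e_{j_1},\dots,e_{j_m})\right|^{q_m}\right)^{\frac{q_{m-1}}{q_m}}\cdots\right)^{\frac{q_2}{q_3}}\right)^{\frac{q_1}{q_2}}\right)^{\frac{1}{q_1}}\leq C\,\|T\|$$ for all continuous $m$-linear forms $T:c_0\times\cdots\times c_0\to\mathbb{R}$ and all positive integers $n$, and the smallest such constant, denoted $C_{m,\mathbf{q}}^{\mathbb{R}}$, satisfies $$C_{m,\mathbf{q}}^{\mathbb{R}}\geq 2^{\frac{(m-1)\widehat{q}_{2,m}+\left(\sum_{1\le i\le m,\ i\neq 2}\widehat{q}_{i,m}\right)-(m-1)q_1q_2\cdots q_m}{q_1q_2\cdots q_m}},$$ where $\widehat{q}_{i,m}:=\dfrac{q_1q_2\cdots q_m}{q_i}$ for $1\leq i\leq m$.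
   Context: Here $c_0$ is the real Banach space of real null sequences with the supremum norm, $(e_j)_{j\ge 1}$ is its sequence of canonical unit vectors, and $\|T\|=\sup\{|T(z_1,\dots,z_m)|:\|z_k\|\le 1,\ k=1,\dots,m\}$. *)

theory Defs
  imports "HOL-Analysis.Analysis"
begin

section \<open>The real Banach space of null sequences\<close>

text \<open>Coordinates are numbered from 0, so the canonical unit vectors are
  \<open>c0_unit 0, c0_unit 1, \<dots>\<close> and the first \<open>n\<close> of them are indexed by \<open>{..<n}\<close>.\<close>

typedef c0 = "{x :: nat \<Rightarrow> real. x \<longlonglongrightarrow> 0}"
  morphisms c0_nth Abs_c0
  by (rule exI[of _ "\<lambda>_. 0"]) simp

setup_lifting type_definition_c0

lift_definition c0_unit :: "nat \<Rightarrow> c0" is "\<lambda>j i. if i = j then 1 else 0"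
proof -
  fix j :: nat
  have "eventually (\<lambda>i. (if i = j then 1 else 0) = (0 :: real)) sequentially"
    using eventually_gt_at_top[of j] by eventually_elim auto
  then show "(\<lambda>i. if i = j then 1 else 0 :: real) \<longlonglongrightarrow> 0"
    by (rule tendsto_eventually)
qed

lemma c0_nth_tendsto: "c0_nth x \<longlonglongrightarrow> 0"
  using c0_nth[of x] by simp

lemma c0_eqI: "(\<And>i. c0_nth x i = c0_nth y i) \<Longrightarrow> x = y"
  by transfer auto

lemma c0_nth_bounded: "bounded (range (c0_nth x))"
  using c0_nth_tendsto[of x] convergent_def convergent_imp_bounded by blast

instantiation c0 :: real_vector
begin

lift_definition zero_c0 :: c0 is "\<lambda>_. 0" by simp

lift_definition plus_c0 :: "c0 \<Rightarrow> c0 \<Rightarrow> c0" is "\<lambda>x y i. x i + y i"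
  using tendsto_add by fastforce

lift_definition minus_c0 :: "c0 \<Rightarrow> c0 \<Rightarrow> c0" is "\<lambda>x y i. x i - y i"
  using tendsto_diff by fastforce

lift_definition uminus_c0 :: "c0 \<Rightarrow> c0" is "\<lambda>x i. - x i"
  using tendsto_minus by fastforce

lift_definition scaleR_c0 :: "real \<Rightarrow> c0 \<Rightarrow> c0" is "\<lambda>r x i. r * x i"
  using tendsto_mult_right_zero by blast

instance
  by standard (transfer; simp add: fun_eq_iff algebra_simps)+

end

lemmas c0_nth_simps [simp] =
  zero_c0.rep_eq plus_c0.rep_eq minus_c0.rep_eq uminus_c0.rep_eq scaleR_c0.rep_eq

instantiation c0 :: real_normed_vector
begin

definition norm_c0 :: "c0 \<Rightarrow> real"
  where "norm_c0 x = (SUP i. \<bar>c0_nth x i\<bar>)"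

definition dist_c0 :: "c0 \<Rightarrow> c0 \<Rightarrow> real"
  where "dist_c0 x y = norm (x - y)"

definition sgn_c0 :: "c0 \<Rightarrow> c0"
  where "sgn_c0 x = x /\<^sub>R norm x"

definition uniformity_c0 :: "(c0 \<times> c0) filter"
  where "uniformity_c0 = (INF e\<in>{0 <..}. principal {(x, y). dist x y < e})"

definition open_c0 :: "c0 set \<Rightarrow> bool"
  where "open_c0 S = (\<forall>x\<in>S. \<forall>\<^sub>F (x', y) in uniformity. x' = x \<longrightarrow> y \<in> S)"

lemma c0_nth_le_norm: "\<bar>c0_nth x i\<bar> \<le> norm x"
proof -
  have "bdd_above (range (\<lambda>i. \<bar>c0_nth x i\<bar>))"
    using c0_nth_bounded[of x] unfolding bounded_iff by (metis bdd_aboveI2 rangeI real_norm_def)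
  then show ?thesis
    unfolding norm_c0_def by (intro cSUP_upper) auto
qed

lemma norm_c0_le: "(\<And>i. \<bar>c0_nth x i\<bar> \<le> b) \<Longrightarrow> norm x \<le> b"
  unfolding norm_c0_def by (intro cSUP_least) auto

instance
proof
  fix x y :: c0 and a :: real
  show "norm x = 0 \<longleftrightarrow> x = 0"
  proof
    assume "norm x = 0"
    then show "x = 0"
      using c0_nth_le_norm[of x] by (intro c0_eqI) simp
  qed (simp add: norm_c0_def)
  show "norm (x + y) \<le> norm x + norm y"
  proof (rule norm_c0_le)
    fix i
    show "\<bar>c0_nth (x + y) i\<bar> \<le> norm x + norm y"
      using c0_nth_le_norm[of x i] c0_nth_le_norm[of y i] by simp
  qed
  have le: "norm (b *\<^sub>R z) \<le> \<bar>b\<bar> * norm z" for b :: real and z :: c0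
    by (rule norm_c0_le) (simp add: abs_mult mult_left_mono c0_nth_le_norm)
  show "norm (a *\<^sub>R x) = \<bar>a\<bar> * norm x"
  proof (cases "a = 0")
    case True
    then show ?thesis by (simp add: norm_c0_def)
  next
    case False
    then have "norm x \<le> \<bar>inverse a\<bar> * norm (a *\<^sub>R x)"
      using le[of "inverse a" "a *\<^sub>R x"] by simp
    then have "\<bar>a\<bar> * norm x \<le> norm (a *\<^sub>R x)"
      using False by (simp add: field_simps)
    with le[of a x] show ?thesis by simp
  qed
qed (rule dist_c0_def sgn_c0_def uniformity_c0_def open_c0_def)+

end

instance c0 :: banach
proof
  fix X :: "nat \<Rightarrow> c0"
  assume X: "Cauchy X"
  have nth: "\<bar>c0_nth x i - c0_nth y i\<bar> \<le> dist x y" for x y i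
    using c0_nth_le_norm[of "x - y" i] by (simp add: dist_norm)
  have "Cauchy (\<lambda>k. c0_nth (X k) i)" for i
    unfolding Cauchy_def dist_real_def
    using X nth unfolding Cauchy_def by (meson le_less_trans)
  then have "\<forall>i. \<exists>l. (\<lambda>k. c0_nth (X k) i) \<longlonglongrightarrow> l"
    by (simp add: Cauchy_convergent_iff convergent_def)
  then obtain f where f: "\<And>i. (\<lambda>k. c0_nth (X k) i) \<longlonglongrightarrow> f i"
    by metis
  have unif: "\<exists>N. \<forall>k\<ge>N. \<forall>i. \<bar>c0_nth (X k) i - f i\<bar> \<le> e" if "e > 0" for e
  proof -
    obtain N where N: "\<And>k l. k \<ge> N \<Longrightarrow> l \<ge> N \<Longrightarrow> dist (X k) (X l) < e"
      using metric_CauchyD[OF X \<open>e > 0\<close>] by metis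
    have "\<bar>c0_nth (X k) i - f i\<bar> \<le> e" if k: "k \<ge> N" for k i
    proof (rule tendsto_upperbound)
      show "(\<lambda>l. \<bar>c0_nth (X k) i - c0_nth (X l) i\<bar>) \<longlonglongrightarrow> \<bar>c0_nth (X k) i - f i\<bar>"
        by (intro tendsto_intros f)
      show "\<forall>\<^sub>F l in sequentially. \<bar>c0_nth (X k) i - c0_nth (X l) i\<bar> \<le> e"
        using eventually_ge_at_top[of N]
      proof eventually_elim
        case (elim l)
        show ?case using nth[of "X k" i "X l"] N[OF k elim] by simp
      qed
    qed simp
    then show ?thesis by blast
  qed
  have "f \<longlonglongrightarrow> 0"
  proof (rule LIMSEQ_I)
    fix e :: real assume e: "e > 0"
    obtain N where N: "\<And>i. \<bar>c0_nth (X N) i - f i\<bar> \<le> e / 2"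
      using unif[of "e / 2"] e by auto
    obtain M where M: "\<And>i. i \<ge> M \<Longrightarrow> \<bar>c0_nth (X N) i\<bar> < e / 2"
      using LIMSEQ_D[OF c0_nth_tendsto[of "X N"], of "e / 2"] e by auto
    have "norm (f i - 0) < e" if "i \<ge> M" for i
      using N[of i] M[OF that] unfolding real_norm_def by arith
    then show "\<exists>no. \<forall>n\<ge>no. norm (f n - 0) < e" by blast
  qed
  then have L: "c0_nth (Abs_c0 f) = f"
    by (simp add: Abs_c0_inverse)
  have "X \<longlonglongrightarrow> Abs_c0 f"
  proof (rule LIMSEQ_I)
    fix e :: real assume e: "e > 0"
    obtain N where N: "\<And>k i. k \<ge> N \<Longrightarrow> \<bar>c0_nth (X k) i - f i\<bar> \<le> e / 2"
      using unif[of "e / 2"] e by auto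
    have "norm (X k - Abs_c0 f) < e" if "k \<ge> N" for k
    proof -
      have "norm (X k - Abs_c0 f) \<le> e / 2"
        by (rule norm_c0_le) (use N[OF that] in \<open>simp only: L c0_nth_simps\<close>)
      then show ?thesis using e by simp
    qed
    then show "\<exists>no. \<forall>n\<ge>no. norm (X n - Abs_c0 f) < e" by blast
  qed
  then show "convergent X" by (rule convergentI)
qed


section \<open>Continuous multilinear forms\<close>

text \<open>A point of \<open>c0 \<times> \<dots> \<times> c0\<close> (\<open>m\<close> factors) is an element of
  \<open>PiE {1..m} (\<lambda>_. UNIV)\<close>, which is the carrier of the product topology used below; the values of
  \<open>T\<close> elsewhere are irrelevant.\<close>

definition continuous_multilinear_form :: "nat \<Rightarrow> ((nat \<Rightarrow> c0) \<Rightarrow> real) \<Rightarrow> bool" where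
  "continuous_multilinear_form m T \<longleftrightarrow>
     (\<forall>z \<in> PiE {1..m} (\<lambda>_. UNIV). \<forall>k \<in> {1..m}. linear (\<lambda>x. T (z(k := x)))) \<and>
     continuous_map (product_topology (\<lambda>_. euclidean) {1..m}) euclideanreal T"

definition form_norm :: "nat \<Rightarrow> ((nat \<Rightarrow> c0) \<Rightarrow> real) \<Rightarrow> real" where
  "form_norm m T = Sup {\<bar>T z\<bar> | z. z \<in> PiE {1..m} (\<lambda>_. UNIV) \<and> (\<forall>k \<in> {1..m}. norm (z k) \<le> 1)}"


section \<open>Mixed sums and the optimal constant\<close>

text \<open>\<open>nested_sum m q n T k j\<close> is the part of the iterated sum that starts at the summation over
  \<open>j\<^sub>k\<close>, with \<open>j\<^sub>1, \<dots>, j\<^sub>k\<^sub>-\<^sub>1\<close> already chosen as \<open>j 1, \<dots>, j (k - 1)\<close>; later entries of \<open>j\<close> are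
  overwritten, so for \<open>k = 1\<close> the result does not depend on \<open>j\<close>.\<close>

function nested_sum ::
  "nat \<Rightarrow> (nat \<Rightarrow> real) \<Rightarrow> nat \<Rightarrow> ((nat \<Rightarrow> c0) \<Rightarrow> real) \<Rightarrow> nat \<Rightarrow> (nat \<Rightarrow> nat) \<Rightarrow> real"
where
  "nested_sum m q n T k j =
     (if k < m
      then \<Sum>i<n. nested_sum m q n T (Suc k) (j(k := i)) powr (q k / q (Suc k))
      else \<Sum>i<n. \<bar>T (\<lambda>l\<in>{1..m}. c0_unit ((j(k := i)) l))\<bar> powr q k)"
  by pat_completeness auto
termination
  by (relation "Wellfounded.measure (\<lambda>(m, q, n, T, k, j). m - k)") auto

declare nested_sum.simps [simp del]

definition mixed_sum :: "nat \<Rightarrow> (nat \<Rightarrow> real) \<Rightarrow> nat \<Rightarrow> ((nat \<Rightarrow> c0) \<Rightarrow> real) \<Rightarrow> real" where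
  "mixed_sum m q n T = nested_sum m q n T 1 (\<lambda>_. 0) powr (1 / q 1)"

definition admissible_constant :: "nat \<Rightarrow> (nat \<Rightarrow> real) \<Rightarrow> real \<Rightarrow> bool" where
  "admissible_constant m q C \<longleftrightarrow>
     (\<forall>T n. continuous_multilinear_form m T \<longrightarrow> n \<ge> 1 \<longrightarrow> mixed_sum m q n T \<le> C * form_norm m T)"

definition optimal_constant :: "nat \<Rightarrow> (nat \<Rightarrow> real) \<Rightarrow> real" where
  "optimal_constant m q = (LEAST C. admissible_constant m q C)"

definition q_hat :: "nat \<Rightarrow> (nat \<Rightarrow> real) \<Rightarrow> nat \<Rightarrow> real" where
  "q_hat m q i = (\<Prod>k=1..m. q k) / q i"

end

theory Submission
  imports Defs
begin

text \<open>The inequality holds by interpolation. The exponents \<open>q\<close> with \<open>q k \<in> [1, 2]\<close> and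
  \<open>\<Sum>1 / q k = (m + 1) / 2\<close> are, in terms of reciprocals, convex combinations of the \<open>m\<close> extreme ones that
  equal 1 at a single variable and 2 at all others, and mixed \<open>\<ell>\<^sub>q\<close> norms are bounded by
  geometric means along such combinations (\<open>mixed_norm_interpolation\<close>). For an extreme exponent, Minkowski's
  inequality moves the \<open>\<ell>\<^sub>1\<close> sum to the outside (\<open>mixed_norm_1_2_le\<close>), and there remains Littlewood's
  mixed \<open>(\<ell>\<^sub>1, \<ell>\<^sub>2)\<close> inequality (\<open>mixed_1_2_Littlewood_slices\<close>). It follows from the Khinchine inequality
  with values in a Hilbert space, applied to one variable after the other: a square sum over unit
  vectors is dominated by the value at a suitable signed sum of them, and such a sum has norm at most 1
  in the supremum norm. The Khinchine inequality appears in a form without probability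
  (\<open>Khinchine_sign_choice\<close>), in which signs are chosen greedily so that a lower bound for an expectation
  never decreases. Altogether, \<open>(16 / 9) ^ (m - 1)\<close> is admissible.

  The lower bound comes from testing with one form (\<open>dyadic_form\<close>), which iterates the \<open>2 \<times> 2\<close> form
  \<open>(x\<^sub>0 + x\<^sub>1) y\<^sub>0 + (x\<^sub>0 - x\<^sub>1) y\<^sub>1\<close> along a binary tree of depth \<open>m - 1\<close>. Its norm is at most \<open>2 ^ (m - 1)\<close>, and
  its coefficients are \<open>0\<close> and \<open>\<plusminus>1\<close>. The second variable runs through the \<open>2 ^ (m - 1)\<close> leaves of the tree, and
  every other one has two values for a given leaf. So the mixed sum has logarithm to base 2 at least
  \<open>(m - 1) / q 2 + \<Sum>\<^sub>i\<^sub>\<noteq>\<^sub>2 1 / q i\<close>, and the claimed exponent is this number minus \<open>m - 1\<close>.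

  Finally, the admissible constants form a closed set of reals that is bounded below, so a least one
  exists.\<close>

section \<open>Hoelder inequality for several factors\<close>

text \<open>The weights may vanish. This is harmless with the convention \<open>0 powr 0 = 0\<close>: a zero among the
  \<open>x s\<close> makes the left-hand side zero, so that the logarithm is needed for positive numbers only.\<close>

lemma weighted_AM_GM:
  fixes w x :: "'s \<Rightarrow> real"
  assumes fin: "finite S" and w: "\<And>s. s \<in> S \<Longrightarrow> w s \<ge> 0" and w1: "(\<Sum>s\<in>S. w s) = 1"
    and x: "\<And>s. s \<in> S \<Longrightarrow> x s \<ge> 0"
  shows "(\<Prod>s\<in>S. x s powr w s) \<le> (\<Sum>s\<in>S. w s * x s)"
proof (cases "\<exists>s\<in>S. x s = 0")
  case True
  then have "(\<Prod>s\<in>S. x s powr w s) = 0"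
    using fin by (intro prod_zero) auto
  also have "\<dots> \<le> (\<Sum>s\<in>S. w s * x s)"
    using w x by (intro sum_nonneg) auto
  finally show ?thesis .
next
  case False
  then have pos: "x s > 0" if "s \<in> S" for s
    using x[OF that] that by force
  have "(\<Prod>s\<in>S. x s powr w s) = (\<Prod>s\<in>S. exp (w s * ln (x s)))"
    using pos by (intro prod.cong refl) (force simp: powr_def)
  also have "\<dots> = exp (\<Sum>s\<in>S. w s *\<^sub>R ln (x s))"
    using fin by (simp add: exp_sum)
  also have "\<dots> \<le> (\<Sum>s\<in>S. w s * exp (ln (x s)))"
  proof -
    have "S \<noteq> {}" using w1 by auto
    then show ?thesis
      using convex_on_sum[OF fin _ exp_convex w1 w, of "\<lambda>s. ln (x s)"] by simp
  qed
  also have "\<dots> = (\<Sum>s\<in>S. w s * x s)"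
    using pos by (intro sum.cong) auto
  finally show ?thesis .
qed

text \<open>Dividing each \<open>g s\<close> by its sum reduces the claim to the pointwise inequality between weighted
  arithmetic and geometric means.\<close>

lemma Holder_sum_prod:
  fixes w :: "'s \<Rightarrow> real" and g :: "'s \<Rightarrow> 'i \<Rightarrow> real"
  assumes S: "finite S" and I: "finite I"
    and w: "\<And>s. s \<in> S \<Longrightarrow> w s \<ge> 0" and w1: "(\<Sum>s\<in>S. w s) = 1"
    and g: "\<And>s i. s \<in> S \<Longrightarrow> i \<in> I \<Longrightarrow> g s i \<ge> 0"
  shows "(\<Sum>i\<in>I. \<Prod>s\<in>S. g s i powr w s) \<le> (\<Prod>s\<in>S. (\<Sum>i\<in>I. g s i) powr w s)"
proof (cases "\<exists>s\<in>S. (\<Sum>i\<in>I. g s i) = 0")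
  case True
  then obtain s where s: "s \<in> S" "(\<Sum>i\<in>I. g s i) = 0" by blast
  then have "g s i = 0" if "i \<in> I" for i
    using sum_nonneg_eq_0_iff[OF I, of "g s"] g that by auto
  then have "(\<Sum>i\<in>I. \<Prod>s\<in>S. g s i powr w s) = 0"
    using s(1) S by (intro sum.neutral ballI prod_zero) auto
  then show ?thesis by (simp add: prod_nonneg)
next
  case False
  define G where "G s = (\<Sum>i\<in>I. g s i)" for s
  have G: "G s > 0" if "s \<in> S" for s
    using False that g[OF that] sum_nonneg[of I "g s"] unfolding G_def by force
  have "(\<Sum>i\<in>I. \<Prod>s\<in>S. g s i powr w s)
      = (\<Sum>i\<in>I. (\<Prod>s\<in>S. G s powr w s) * (\<Prod>s\<in>S. (g s i / G s) powr w s))"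
    using G g by (intro sum.cong refl, subst prod.distrib[symmetric], intro prod.cong refl)
      (subst powr_mult[symmetric], auto simp: less_imp_neq[symmetric])
  also have "\<dots> \<le> (\<Sum>i\<in>I. (\<Prod>s\<in>S. G s powr w s) * (\<Sum>s\<in>S. w s * (g s i / G s)))"
    using S w w1 G g
    by (intro sum_mono mult_left_mono weighted_AM_GM prod_nonneg) (auto simp: less_imp_le)
  also have "\<dots> = (\<Prod>s\<in>S. G s powr w s) * (\<Sum>i\<in>I. \<Sum>s\<in>S. w s * (g s i / G s))"
    by (simp add: sum_distrib_left)
  also have "(\<Sum>i\<in>I. \<Sum>s\<in>S. w s * (g s i / G s)) = (\<Sum>s\<in>S. \<Sum>i\<in>I. w s * (g s i / G s))"
    by (rule sum.swap)
  also have "\<dots> = (\<Sum>s\<in>S. w s * ((\<Sum>i\<in>I. g s i) / G s))"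
    by (simp only: sum_distrib_left sum_divide_distrib)
  also have "\<dots> = (\<Sum>s\<in>S. w s * (G s / G s))"
    by (simp only: G_def)
  also have "\<dots> = (\<Sum>s\<in>S. w s)"
    using G by (intro sum.cong refl) force
  finally show ?thesis by (simp add: w1 G_def)
qed

section \<open>Mixed norms and their interpolation\<close>

text \<open>The iterated norm lives on functions \<open>a\<close> of a whole assignment \<open>z\<close>: summing over the variable
  \<open>k\<close> substitutes \<open>e 0, \<dots>, e (n - 1)\<close> for \<open>z k\<close>. Listing the variables, outermost first, makes
  inductions structural, and keeping \<open>z\<close> instead of indices lets arbitrary vectors be put into the
  remaining variables, which the sign choices below require.\<close>

fun mixed_norm ::
  "(nat \<Rightarrow> real) \<Rightarrow> nat \<Rightarrow> (nat \<Rightarrow> 'a) \<Rightarrow> ((nat \<Rightarrow> 'a) \<Rightarrow> real) \<Rightarrow> nat list \<Rightarrow> (nat \<Rightarrow> 'a) \<Rightarrow> real"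
where
  "mixed_norm p n e a [] z = \<bar>a z\<bar>"
| "mixed_norm p n e a (k # ks) z =
     (\<Sum>i<n. mixed_norm p n e a ks (z(k := e i)) powr p k) powr (1 / p k)"

lemma mixed_norm_nonneg: "mixed_norm p n e a ks z \<ge> 0"
  by (cases ks) auto

lemma mixed_norm_Cons_ge:
  assumes "I \<subseteq> {..<n}" "p k > 0" "M \<ge> 0"
    and M: "\<And>i. i \<in> I \<Longrightarrow> M \<le> mixed_norm p n e a ks (z(k := e i))"
  shows "real (card I) powr (1 / p k) * M \<le> mixed_norm p n e a (k # ks) z"
proof -
  have "real (card I) * M powr p k = (\<Sum>i\<in>I. M powr p k)" by simp
  also have "\<dots> \<le> (\<Sum>i\<in>I. mixed_norm p n e a ks (z(k := e i)) powr p k)"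
    using assms by (intro sum_mono powr_mono2) auto
  also have "\<dots> \<le> (\<Sum>i<n. mixed_norm p n e a ks (z(k := e i)) powr p k)"
    using assms by (intro sum_mono2) auto
  finally have "(real (card I) * M powr p k) powr (1 / p k) \<le> mixed_norm p n e a (k # ks) z"
    using assms by (auto intro!: powr_mono2)
  moreover have "(real (card I) * M powr p k) powr (1 / p k) = real (card I) powr (1 / p k) * M"
    using assms by (simp add: powr_mult powr_powr)
  ultimately show ?thesis by simp
qed

text \<open>The reciprocal exponents \<open>1 / q\<close> are a convex combination of the \<open>1 / p s\<close>, with the same weights at
  every variable. From the inside outwards, each summation turns a bound by a geometric mean of
  the mixed norms into another one, by the inequality of Hoelder with weights \<open>\<theta> s * q k / p s k\<close>.\<close>

lemma mixed_norm_interpolation: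
  fixes \<theta> :: "'s \<Rightarrow> real" and p :: "'s \<Rightarrow> nat \<Rightarrow> real"
  assumes S: "finite S" and th: "\<And>s. s \<in> S \<Longrightarrow> \<theta> s \<ge> 0" and th1: "(\<Sum>s\<in>S. \<theta> s) = 1"
    and "\<And>s k. s \<in> S \<Longrightarrow> k \<in> set ks \<Longrightarrow> p s k > 0"
    and "\<And>k. k \<in> set ks \<Longrightarrow> q k > 0"
    and "\<And>k. k \<in> set ks \<Longrightarrow> 1 / q k = (\<Sum>s\<in>S. \<theta> s / p s k)"
  shows "mixed_norm q n e a ks z \<le> (\<Prod>s\<in>S. mixed_norm (p s) n e a ks z powr \<theta> s)"
  using assms(4-)
proof (induction ks arbitrary: z)
  case Nil
  show ?case
  proof (cases "a z = 0")
    case False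
    then have "(\<Prod>s\<in>S. \<bar>a z\<bar> powr \<theta> s) = \<bar>a z\<bar>"
      using powr_sum[of "\<bar>a z\<bar>" \<theta> S] S th1 by simp
    then show ?thesis by simp
  qed (simp add: prod_nonneg)
next
  case (Cons k ks)
  define M where "M s i = mixed_norm (p s) n e a ks (z(k := e i))" for s i
  define N where "N i = mixed_norm q n e a ks (z(k := e i))" for i
  have N0: "N i \<ge> 0" for i by (simp add: N_def mixed_norm_nonneg)
  have IH: "N i \<le> (\<Prod>s\<in>S. M s i powr \<theta> s)" for i
    unfolding N_def M_def using Cons by auto
  have pk: "p s k > 0" if "s \<in> S" for s
    using Cons.prems that by auto
  have q0: "q k > 0" using Cons.prems by auto
  have rel: "1 / q k = (\<Sum>s\<in>S. \<theta> s / p s k)"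
    using Cons.prems by auto
  have w1: "(\<Sum>s\<in>S. \<theta> s * q k / p s k) = 1"
  proof -
    have "(\<Sum>s\<in>S. \<theta> s * q k / p s k) = q k * (\<Sum>s\<in>S. \<theta> s / p s k)"
      by (simp add: sum_distrib_left mult_ac)
    then show ?thesis using rel[symmetric] q0 by simp
  qed
  have "(\<Sum>i<n. N i powr q k) \<le> (\<Sum>i<n. (\<Prod>s\<in>S. M s i powr \<theta> s) powr q k)"
    using q0 N0 IH by (intro sum_mono powr_mono2) auto
  also have "\<dots> = (\<Sum>i<n. \<Prod>s\<in>S. (M s i powr p s k) powr (\<theta> s * q k / p s k))"
  proof (intro sum.cong refl)
    fix i
    have "(\<Prod>s\<in>S. M s i powr \<theta> s) powr q k = (\<Prod>s\<in>S. (M s i powr \<theta> s) powr q k)"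
      by (rule prod_powr_distrib)
    also have "\<dots> = (\<Prod>s\<in>S. (M s i powr p s k) powr (\<theta> s * q k / p s k))"
      using pk by (intro prod.cong refl) (force simp: powr_powr)
    finally show "(\<Prod>s\<in>S. M s i powr \<theta> s) powr q k
      = (\<Prod>s\<in>S. (M s i powr p s k) powr (\<theta> s * q k / p s k))" .
  qed
  also have "\<dots> \<le> (\<Prod>s\<in>S. (\<Sum>i<n. M s i powr p s k) powr (\<theta> s * q k / p s k))"
    using S th q0 w1 by (intro Holder_sum_prod) (auto simp: less_imp_le[OF pk])
  finally have "(\<Sum>i<n. N i powr q k) powr (1 / q k)
      \<le> (\<Prod>s\<in>S. (\<Sum>i<n. M s i powr p s k) powr (\<theta> s * q k / p s k)) powr (1 / q k)"
    using q0 by (intro powr_mono2) (auto intro: sum_nonneg)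
  also have "\<dots> = (\<Prod>s\<in>S. ((\<Sum>i<n. M s i powr p s k) powr (\<theta> s * q k / p s k)) powr (1 / q k))"
    by (rule prod_powr_distrib)
  also have "\<dots> = (\<Prod>s\<in>S. ((\<Sum>i<n. M s i powr p s k) powr (1 / p s k)) powr \<theta> s)"
    using q0 by (intro prod.cong refl) (simp add: powr_powr)
  finally show ?case by (simp add: N_def M_def)
qed

section \<open>Khinchine inequality by a choice of signs\<close>

text \<open>Here \<open>Q\<close> is the squared norm of \<open>\<ell>\<^sub>2(X)\<close>. For independent random signs, the random vector
  \<open>u + \<Sum>\<epsilon>\<^sub>i v\<^sub>i\<close> has second moment \<open>A + V\<close> and fourth moment at most
  \<open>A\<^sup>2 + 6 A V + 3 V\<^sup>2\<close>, where \<open>A = Q u\<close> and \<open>V = \<Sum>Q v\<^sub>i\<close>. So \<open>F k A V\<close> is a lower bound for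
  the expectation of \<open>\<alpha> k\<close> times the square minus \<open>\<beta> k\<close> times the fourth power of the norm. The signs
  are fixed one after the other: the bound is at most the average of its values after the two
  choices of the next sign, hence one of the two choices does not decrease the total over \<open>k\<close>.\<close>

lemma sign_choice_potential:
  fixes v :: "'k \<Rightarrow> nat \<Rightarrow> 'x \<Rightarrow> real" and X :: "'x set" and \<alpha> \<beta> :: "'k \<Rightarrow> real"
  assumes \<beta>: "\<And>k. k \<in> K \<Longrightarrow> \<beta> k \<ge> 0"
  defines "Q \<equiv> \<lambda>f :: 'x \<Rightarrow> real. (\<Sum>x\<in>X. (f x)\<^sup>2)"
  defines "F \<equiv> \<lambda>k A V. \<alpha> k * (A + V) - \<beta> k * (A\<^sup>2 + 6 * A * V + 3 * V\<^sup>2) :: real"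
  shows "\<exists>\<epsilon>. (\<forall>i. \<epsilon> i \<in> {-1, 1}) \<and>
    (\<Sum>k\<in>K. F k (Q (u k)) (\<Sum>i<n. Q (v k i))) \<le> (\<Sum>k\<in>K. F k (Q (\<lambda>x. u k x + (\<Sum>i<n. \<epsilon> i * v k i x))) 0)"
proof (induction n arbitrary: u)
  case 0
  show ?case by (intro exI[of _ "\<lambda>_. 1"]) simp
next
  case (Suc n)
  define V where "V k = (\<Sum>i<n. Q (v k i))" for k
  define R where "R \<delta> = (\<Sum>k\<in>K. F k (Q (\<lambda>x. u k x + \<delta> * v k n x)) (V k))" for \<delta>
  have step: "F k (Q (u k)) (V k + Q (v k n))
      \<le> (F k (Q (\<lambda>x. u k x + 1 * v k n x)) (V k) + F k (Q (\<lambda>x. u k x + (-1) * v k n x)) (V k)) / 2"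
    if k: "k \<in> K" for k
  proof -
    define c where "c = (\<Sum>x\<in>X. u k x * v k n x)"
    have c: "c\<^sup>2 \<le> Q (u k) * Q (v k n)"
      unfolding c_def Q_def by (rule Cauchy_Schwarz_ineq_sum)
    have plus: "Q (\<lambda>x. u k x + 1 * v k n x) = Q (u k) + Q (v k n) + 2 * c"
      by (simp add: Q_def c_def power2_sum sum.distrib sum_distrib_left mult_ac)
    have minus: "Q (\<lambda>x. u k x + (-1) * v k n x) = Q (u k) + Q (v k n) - 2 * c"
      by (simp add: Q_def c_def power2_diff sum.distrib sum_distrib_left sum_subtractf mult_ac)
    have "(F k (Q (u k) + Q (v k n) + 2 * c) (V k) + F k (Q (u k) + Q (v k n) - 2 * c) (V k)) / 2
        - F k (Q (u k)) (V k + Q (v k n))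
      = \<beta> k * (4 * (Q (u k) * Q (v k n) - c\<^sup>2) + 2 * (Q (v k n))\<^sup>2)"
      unfolding F_def by (simp add: field_simps power2_eq_square)
    also have "\<dots> \<ge> 0" using c \<beta>[OF k] by simp
    finally show ?thesis unfolding plus minus by simp
  qed
  have "(\<Sum>k\<in>K. F k (Q (u k)) (\<Sum>i<Suc n. Q (v k i))) \<le> (\<Sum>k\<in>K. (F k (Q (\<lambda>x. u k x + 1 * v k n x)) (V k)
      + F k (Q (\<lambda>x. u k x + (-1) * v k n x)) (V k)) / 2)"
    using step by (intro sum_mono) (simp add: V_def)
  also have "\<dots> = (R 1 + R (-1)) / 2"
    unfolding R_def by (simp only: sum.distrib flip: sum_divide_distrib)
  also have "\<dots> \<le> max (R 1) (R (-1))" by simp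
  finally obtain \<delta> where \<delta>: "\<delta> \<in> {-1, 1}"
    "(\<Sum>k\<in>K. F k (Q (u k)) (\<Sum>i<Suc n. Q (v k i))) \<le> R \<delta>"
    by (cases "R 1 \<le> R (-1)") (auto simp: max_def)
  obtain \<epsilon> where \<epsilon>: "\<forall>i. \<epsilon> i \<in> {-1, 1}"
    "R \<delta> \<le> (\<Sum>k\<in>K. F k (Q (\<lambda>x. (u k x + \<delta> * v k n x) + (\<Sum>i<n. \<epsilon> i * v k i x))) 0)"
    using Suc.IH[of "\<lambda>k x. u k x + \<delta> * v k n x"] unfolding R_def V_def by blast
  have eq: "(u k x + \<delta> * v k n x) + (\<Sum>i<n. \<epsilon> i * v k i x)
      = u k x + (\<Sum>i<Suc n. (\<epsilon>(n := \<delta>)) i * v k i x)" for k x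
    by simp
  have "\<forall>i. (\<epsilon>(n := \<delta>)) i \<in> {-1, 1}"
    using \<epsilon>(1) \<delta>(1) by simp
  moreover note order.trans[OF \<delta>(2) \<epsilon>(2), unfolded eq]
  ultimately show ?case by blast
qed

text \<open>The norm \<open>t\<close> of a signed sum is bounded below by its second and fourth power, through
  \<open>t \<ge> 3 / 4 * t\<^sup>2 / \<sigma> - 1 / 16 * t^4 / \<sigma>^3\<close>. If \<open>\<sigma>\<^sup>2\<close> is the second moment, then the fourth
  moment is at most \<open>3 * \<sigma>^4\<close>, and the right-hand side has mean at least
  \<open>(3 / 4 - 3 / 16) * \<sigma> = 9 / 16 * \<sigma>\<close>. One choice of signs serves all \<open>k\<close> together.\<close>

lemma Khinchine_sign_choice:
  fixes v :: "'k \<Rightarrow> nat \<Rightarrow> 'x \<Rightarrow> real" and X :: "'x set"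
  shows "\<exists>\<epsilon>. (\<forall>i. \<epsilon> i \<in> {-1, 1}) \<and>
    (\<Sum>k\<in>K. L2_set (\<lambda>i. L2_set (v k i) X) {..<n})
      \<le> 16 / 9 * (\<Sum>k\<in>K. L2_set (\<lambda>x. \<Sum>i<n. \<epsilon> i * v k i x) X)"
proof -
  define Q where "Q f = (\<Sum>x\<in>X. (f x)\<^sup>2)" for f :: "'x \<Rightarrow> real"
  define \<sigma> where "\<sigma> k = L2_set (\<lambda>i. L2_set (v k i) X) {..<n}" for k
  have Q: "(L2_set f X)\<^sup>2 = Q f" for f
    by (simp add: L2_set_def Q_def sum_nonneg)
  have \<sigma>: "(\<sigma> k)\<^sup>2 = (\<Sum>i<n. Q (v k i))" for k
    unfolding \<sigma>_def L2_set_def[of _ "{..<n}"] by (simp add: sum_nonneg flip: Q)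
  have \<sigma>0: "\<sigma> k \<ge> 0" for k by (simp add: \<sigma>_def)
  obtain \<epsilon> where \<epsilon>: "\<forall>i. \<epsilon> i \<in> {-1, 1}" and le:
    "(\<Sum>k\<in>K. 3 / (4 * \<sigma> k) * (\<Sum>i<n. Q (v k i)) - 1 / (16 * \<sigma> k ^ 3) * (3 * (\<Sum>i<n. Q (v k i))\<^sup>2))
     \<le> (\<Sum>k\<in>K. 3 / (4 * \<sigma> k) * Q (\<lambda>x. \<Sum>i<n. \<epsilon> i * v k i x)
          - 1 / (16 * \<sigma> k ^ 3) * (Q (\<lambda>x. \<Sum>i<n. \<epsilon> i * v k i x))\<^sup>2)"
    using sign_choice_potential[where K = K and \<beta> = "\<lambda>k. 1 / (16 * \<sigma> k ^ 3)"
        and \<alpha> = "\<lambda>k. 3 / (4 * \<sigma> k)" and X = X and u = "\<lambda>_ _. 0" and n = n and v = v] \<sigma>0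
    unfolding Q_def by auto
  define t where "t k = L2_set (\<lambda>x. \<Sum>i<n. \<epsilon> i * v k i x) X" for k
  have "9 / 16 * (\<Sum>k\<in>K. \<sigma> k) = (\<Sum>k\<in>K. 3 / (4 * \<sigma> k) * (\<sigma> k)\<^sup>2 - 1 / (16 * \<sigma> k ^ 3) * (3 * ((\<sigma> k)\<^sup>2)\<^sup>2))"
    unfolding sum_distrib_left
    by (intro sum.cong refl) (auto simp: field_simps power2_eq_square power3_eq_cube)
  also have "\<dots> \<le> (\<Sum>k\<in>K. 3 / (4 * \<sigma> k) * (t k)\<^sup>2 - 1 / (16 * \<sigma> k ^ 3) * ((t k)\<^sup>2)\<^sup>2)"
    using le by (simp add: \<sigma> t_def Q)
  also have "\<dots> \<le> (\<Sum>k\<in>K. t k)"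
  proof (intro sum_mono)
    fix k
    have t0: "t k \<ge> 0" by (simp add: t_def)
    \<comment> \<open>If \<open>\<sigma> k = 0\<close>, then both coefficients are 0, since division by zero gives zero.\<close>
    show "3 / (4 * \<sigma> k) * (t k)\<^sup>2 - 1 / (16 * \<sigma> k ^ 3) * ((t k)\<^sup>2)\<^sup>2 \<le> t k"
    proof (cases "\<sigma> k = 0")
      case False
      then have s: "\<sigma> k > 0" using \<sigma>0[of k] by simp
      define r where "r = t k / \<sigma> k"
      have r: "r \<ge> 0" "t k = r * \<sigma> k" using s t0 by (auto simp: r_def)
      \<comment> \<open>The coefficients are chosen so that the cubic has a double root at \<open>r = 2\<close>: it is \<open>r^3 - 12 * r + 16\<close>.\<close>
      have "0 \<le> r * ((r - 2)\<^sup>2 * (r + 4))" using r by simp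
      then have "3 / 4 * r\<^sup>2 - 1 / 16 * (r\<^sup>2)\<^sup>2 \<le> r"
        by (simp add: power2_eq_square algebra_simps)
      then have "\<sigma> k * (3 / 4 * r\<^sup>2 - 1 / 16 * (r\<^sup>2)\<^sup>2) \<le> \<sigma> k * r"
        using s by (intro mult_left_mono) auto
      moreover have "3 / (4 * \<sigma> k) * (t k)\<^sup>2 - 1 / (16 * \<sigma> k ^ 3) * ((t k)\<^sup>2)\<^sup>2
          = \<sigma> k * (3 / 4 * r\<^sup>2 - 1 / 16 * (r\<^sup>2)\<^sup>2)"
        using s unfolding r(2) by (simp add: field_simps power2_eq_square power3_eq_cube)
      ultimately show ?thesis by (simp add: r mult.commute)
    qed (use t0 in simp)
  qed
  finally have "(\<Sum>k\<in>K. \<sigma> k) \<le> 16 / 9 * (\<Sum>k\<in>K. t k)" by simp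
  with \<epsilon> show ?thesis unfolding \<sigma>_def t_def by blast
qed

section \<open>Littlewood's mixed inequality for multilinear forms\<close>

definition fill :: "(nat \<Rightarrow> 'a) \<Rightarrow> nat set \<Rightarrow> (nat \<Rightarrow> nat) \<Rightarrow> (nat \<Rightarrow> 'a) \<Rightarrow> nat \<Rightarrow> 'a" where
  "fill e L x z = (\<lambda>l. if l \<in> L then e (x l) else z l)"

text \<open>All exponents are 2 here. Then the order of summation does not matter, and \<open>L\<close> can be a set.\<close>

definition slice_norm ::
  "nat \<Rightarrow> (nat \<Rightarrow> 'a) \<Rightarrow> ((nat \<Rightarrow> 'a) \<Rightarrow> real) \<Rightarrow> nat set \<Rightarrow> (nat \<Rightarrow> 'a) \<Rightarrow> real" where
  "slice_norm n e a L z = L2_set (\<lambda>x. a (fill e L x z)) (PiE L (\<lambda>_. {..<n}))"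

lemma slice_norm_nonneg: "slice_norm n e a L z \<ge> 0"
  by (simp add: slice_norm_def)

lemma slice_norm_empty: "slice_norm n e a {} z = \<bar>a z\<bar>"
  by (simp add: slice_norm_def fill_def L2_set_def)

lemma fill_upd: "l \<notin> L \<Longrightarrow> fill e L x (z(l := w)) = (fill e L x z)(l := w)"
  by (auto simp: fill_def)

lemma slice_norm_insert:
  assumes l: "l \<notin> L"
  shows "slice_norm n e a (insert l L) z = L2_set (\<lambda>i. slice_norm n e a L (z(l := e i))) {..<n}"
proof -
  have eq: "fill e (insert l L) (g(l := i)) z = fill e L g (z(l := e i))" for g i
    using l by (auto simp: fill_def)
  have "(\<Sum>h\<in>PiE (insert l L) (\<lambda>_. {..<n}). (a (fill e (insert l L) h z))\<^sup>2)
      = (\<Sum>(i, g)\<in>{..<n} \<times> PiE L (\<lambda>_. {..<n}). (a (fill e L g (z(l := e i))))\<^sup>2)"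
    unfolding PiE_insert_eq
    by (subst sum.reindex[OF inj_combinator[OF l]]) (auto simp: eq intro!: sum.cong)
  also have "\<dots> = (\<Sum>i<n. \<Sum>g\<in>PiE L (\<lambda>_. {..<n}). (a (fill e L g (z(l := e i))))\<^sup>2)"
    by (rule sum.cartesian_product[symmetric])
  finally show ?thesis
    by (simp add: slice_norm_def L2_set_def sum_nonneg)
qed

lemma mixed_norm_Cons_2:
  assumes "p k = 2"
  shows "mixed_norm p n e a (k # ks) z = L2_set (\<lambda>i. mixed_norm p n e a ks (z(k := e i))) {..<n}"
  using assms by (simp add: L2_set_def powr_half_sqrt sum_nonneg mixed_norm_nonneg)

lemma mixed_norm_2:
  assumes "distinct ks" "\<And>l. l \<in> set ks \<Longrightarrow> p l = 2"
  shows "mixed_norm p n e a ks z = slice_norm n e a (set ks) z"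
  using assms
proof (induction ks arbitrary: z)
  case (Cons k ks)
  then show ?case
    by (subst mixed_norm_Cons_2) (auto simp: slice_norm_insert)
qed (simp add: slice_norm_empty)

lemma L2_set_sum_le:
  assumes "finite I"
  shows "L2_set (\<lambda>x. \<Sum>i\<in>I. f i x) X \<le> (\<Sum>i\<in>I. L2_set (f i) X)"
  using assms
proof (induction I rule: finite_induct)
  case empty
  then show ?case by (simp add: L2_set_def)
next
  case (insert i I)
  then show ?case
    using L2_set_triangle_ineq[of "f i" "\<lambda>x. \<Sum>i\<in>I. f i x" X] by simp
qed

text \<open>The summation over \<open>k\<close>, which has exponent 1, is moved outwards past every summation with
  exponent 2. Each exchange is the triangle inequality of \<open>\<ell>\<^sub>2\<close>.\<close>

lemma mixed_norm_1_2_le: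
  assumes "distinct ks" "k \<in> set ks" "p k = 1" "\<And>l. l \<in> set ks \<Longrightarrow> l \<noteq> k \<Longrightarrow> p l = 2"
  shows "mixed_norm p n e a ks z \<le> (\<Sum>i<n. slice_norm n e a (set ks - {k}) (z(k := e i)))"
  using assms
proof (induction ks arbitrary: z)
  case (Cons l ks)
  show ?case
  proof (cases "l = k")
    case True
    have "mixed_norm p n e a ks (z(k := e i)) = slice_norm n e a (set ks) (z(k := e i))" for i
      using Cons.prems True by (intro mixed_norm_2) auto
    moreover have "set (l # ks) - {k} = set ks"
      using Cons.prems(1) True by auto
    ultimately show ?thesis
      using True Cons.prems(3) by (simp add: sum_nonneg slice_norm_nonneg del: fun_upd_apply)
  next
    case False
    have "mixed_norm p n e a (l # ks) z = L2_set (\<lambda>i. mixed_norm p n e a ks (z(l := e i))) {..<n}"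
      using Cons.prems False by (intro mixed_norm_Cons_2) auto
    also have "\<dots> \<le> L2_set (\<lambda>i'. \<Sum>i<n. slice_norm n e a (set ks - {k}) (z(l := e i', k := e i))) {..<n}"
      using Cons.prems False
      by (intro L2_set_mono mixed_norm_nonneg Cons.IH) auto
    also have "\<dots> \<le> (\<Sum>i<n. L2_set (\<lambda>i'. slice_norm n e a (set ks - {k}) (z(l := e i', k := e i))) {..<n})"
      by (intro L2_set_sum_le) simp
    also have "\<dots> = (\<Sum>i<n. slice_norm n e a (insert l (set ks - {k})) (z(k := e i)))"
      using Cons.prems(1) False
      by (subst slice_norm_insert) (auto simp: fun_upd_twist[OF False])
    also have "insert l (set ks - {k}) = set (l # ks) - {k}"
      using False by auto
    finally show ?thesis .
  qed
qed simp

definition unit_polyball :: "nat \<Rightarrow> (nat \<Rightarrow> 'a :: real_normed_vector) set" where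
  "unit_polyball m = {z \<in> PiE {1..m} (\<lambda>_. UNIV). \<forall>k\<in>{1..m}. norm (z k) \<le> 1}"

lemma unit_polyball_upd:
  "z \<in> unit_polyball m \<Longrightarrow> k \<in> {1..m} \<Longrightarrow> norm w \<le> 1 \<Longrightarrow> z(k := w) \<in> unit_polyball m"
  by (auto simp: unit_polyball_def PiE_iff extensional_def)

lemma c0_nth_sum: "c0_nth (\<Sum>i\<in>A. f i) j = (\<Sum>i\<in>A. c0_nth (f i) j)"
  by (induction A rule: infinite_finite_induct) auto

lemma c0_nth_unit: "c0_nth (c0_unit j) i = (if i = j then 1 else 0)"
  by transfer simp

lemma norm_c0_unit_le: "norm (c0_unit i) \<le> 1"
  by (rule norm_c0_le) (simp add: c0_nth_unit)

text \<open>This is what the supremum norm contributes: signed sums of unit vectors stay in the unit ball.\<close>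

lemma norm_signed_units_le:
  assumes "\<forall>i. \<epsilon> i \<in> {-1, 1}"
  shows "norm (\<Sum>i<n. \<epsilon> i *\<^sub>R c0_unit i) \<le> 1"
proof (rule norm_c0_le)
  fix j
  have "c0_nth (\<Sum>i<n. \<epsilon> i *\<^sub>R c0_unit i) j = (\<Sum>i<n. if j = i then \<epsilon> i else 0)"
    by (simp add: c0_nth_sum c0_nth_unit if_distrib cong: if_cong)
  also have "\<bar>\<dots>\<bar> \<le> 1"
    using spec[OF assms, of j] by auto
  finally show "\<bar>c0_nth (\<Sum>i<n. \<epsilon> i *\<^sub>R c0_unit i) j\<bar> \<le> 1" .
qed

text \<open>Each variable in \<open>L\<close> is removed by one application of the Khinchine inequality, at the cost of a
  factor \<open>16 / 9\<close>: the square sum over its unit vectors is replaced by the value at one signed sum of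
  them, which is again an admissible argument of \<open>T\<close>. What remains is an \<open>\<ell>\<^sub>1\<close> sum over the variable
  \<open>k\<close>, and it equals the value of \<open>T\<close> at another signed sum.\<close>

lemma mixed_1_2_Littlewood_slices:
  fixes T :: "(nat \<Rightarrow> c0) \<Rightarrow> real"
  assumes lin: "\<And>z k. z \<in> PiE {1..m} (\<lambda>_. UNIV) \<Longrightarrow> k \<in> {1..m} \<Longrightarrow> linear (\<lambda>x. T (z(k := x)))"
    and B: "\<And>z. z \<in> unit_polyball m \<Longrightarrow> \<bar>T z\<bar> \<le> B"
    and "finite L" "L \<subseteq> {1..m}" "k \<in> {1..m}" "k \<notin> L" "z \<in> unit_polyball m"
  shows "(\<Sum>i<n. slice_norm n c0_unit T L (z(k := c0_unit i))) \<le> (16 / 9) ^ card L * B"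
  using assms(3-)
proof (induction L arbitrary: z rule: finite_induct)
  case empty
  define \<epsilon> where "\<epsilon> i = (if T (z(k := c0_unit i)) \<ge> 0 then 1 else - 1 :: real)" for i
  interpret L: linear "\<lambda>x. T (z(k := x))"
    using empty by (intro lin) (auto simp: unit_polyball_def)
  have "(\<Sum>i<n. slice_norm n c0_unit T {} (z(k := c0_unit i))) = (\<Sum>i<n. \<epsilon> i * T (z(k := c0_unit i)))"
    by (intro sum.cong) (auto simp: slice_norm_empty \<epsilon>_def)
  also have "\<dots> = T (z(k := (\<Sum>i<n. \<epsilon> i *\<^sub>R c0_unit i)))"
    by (simp add: L.sum L.scaleR)
  also have "\<dots> \<le> B"
    using empty by (intro order.trans[OF abs_ge_self B] unit_polyball_upd norm_signed_units_le)
      (auto simp: \<epsilon>_def)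
  finally show ?case by (simp del: fun_upd_apply)
next
  case (insert l L)
  have kl: "k \<noteq> l" and l: "l \<in> {1..m}" using insert.prems by auto
  define v where "v i j x = T (fill c0_unit L x (z(k := c0_unit i, l := c0_unit j)))" for i j x
  define X where "X = PiE L (\<lambda>_. {..<n})"
  obtain \<epsilon> where \<epsilon>: "\<forall>i. \<epsilon> i \<in> {-1, 1}" and le:
    "(\<Sum>i<n. L2_set (\<lambda>j. L2_set (v i j) X) {..<n})
      \<le> 16 / 9 * (\<Sum>i<n. L2_set (\<lambda>x. \<Sum>j<n. \<epsilon> j * v i j x) X)"
    using Khinchine_sign_choice[where K = "{..<n}" and v = v and X = X and n = n] by blast
  define w where "w = (\<Sum>j<n. \<epsilon> j *\<^sub>R c0_unit j)"
  have comb: "(\<Sum>j<n. \<epsilon> j * v i j x) = T (fill c0_unit L x (z(l := w, k := c0_unit i)))" for i x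
  proof -
    have "fill c0_unit L x (z(k := c0_unit i)) \<in> PiE {1..m} (\<lambda>_. UNIV)"
      using insert.prems by (auto simp: fill_def unit_polyball_def PiE_iff extensional_def)
    then interpret L: linear "\<lambda>y. T ((fill c0_unit L x (z(k := c0_unit i)))(l := y))"
      using l by (rule lin)
    have "(\<Sum>j<n. \<epsilon> j * v i j x) = T ((fill c0_unit L x (z(k := c0_unit i)))(l := w))"
      using insert.hyps by (simp add: v_def w_def fill_upd L.sum L.scaleR)
    then show ?thesis
      using insert.hyps by (simp add: fill_upd[symmetric] fun_upd_twist[OF kl])
  qed
  have "(\<Sum>i<n. slice_norm n c0_unit T (insert l L) (z(k := c0_unit i)))
      = (\<Sum>i<n. L2_set (\<lambda>j. L2_set (v i j) X) {..<n})"
    by (simp only: slice_norm_insert[OF insert.hyps(2)]) (simp add: slice_norm_def v_def[abs_def] X_def)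
  also note le
  also have "(\<Sum>i<n. L2_set (\<lambda>x. \<Sum>j<n. \<epsilon> j * v i j x) X)
      = (\<Sum>i<n. slice_norm n c0_unit T L ((z(l := w))(k := c0_unit i)))"
    by (simp add: comb slice_norm_def X_def)
  also have "\<dots> \<le> (16 / 9) ^ card L * B"
    using insert.prems l \<epsilon>
    by (intro insert.IH unit_polyball_upd) (auto simp: w_def intro!: norm_signed_units_le)
  finally show ?case
    using insert.hyps by simp
qed

text \<open>The points \<open>1 / q\<close> with \<open>q k \<in> [1, 2]\<close> and \<open>\<Sum>1 / q k = (m + 1) / 2\<close> form a simplex. Its vertices are
  the reciprocals of the exponents \<open>p s\<close>, equal to 1 at \<open>s\<close> and to 2 elsewhere, and the barycentric
  coordinates are \<open>\<theta> s = 2 / q s - 1\<close>. At every vertex the bound is the mixed inequality above, so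
  interpolation gives it, with the same constant, on the whole simplex.\<close>

theorem anisotropic_Bohnenblust_Hille:
  fixes T :: "(nat \<Rightarrow> c0) \<Rightarrow> real"
  assumes lin: "\<And>z k. z \<in> PiE {1..m} (\<lambda>_. UNIV) \<Longrightarrow> k \<in> {1..m} \<Longrightarrow> linear (\<lambda>x. T (z(k := x)))"
    and B: "\<And>z. z \<in> unit_polyball m \<Longrightarrow> \<bar>T z\<bar> \<le> B"
    and m: "m \<ge> 1"
    and q: "\<And>k. k \<in> {1..m} \<Longrightarrow> q k \<in> {1..2}"
    and sum_q: "(\<Sum>k=1..m. 1 / q k) = (real m + 1) / 2"
    and z: "z \<in> unit_polyball m"
  shows "mixed_norm q n c0_unit T [1..<Suc m] z \<le> (16 / 9) ^ (m - 1) * B"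
proof -
  define p where "p s k = (if k = s then 1 else 2 :: real)" for s k :: nat
  define \<theta> where "\<theta> s = 2 / q s - 1" for s
  define C where "C = (16 / 9) ^ (m - 1) * B"
  have B0: "B \<ge> 0" using B[OF z] by simp
  have \<theta>: "\<theta> s \<ge> 0" if "s \<in> {1..m}" for s
    using q[OF that] by (simp add: \<theta>_def field_simps)
  have \<theta>1: "(\<Sum>s=1..m. \<theta> s) = 1"
  proof -
    have "(\<Sum>s=1..m. \<theta> s) = 2 * (\<Sum>k=1..m. 1 / q k) - real m"
      by (simp add: \<theta>_def sum_subtractf sum_distrib_left)
    then show ?thesis using sum_q by simp
  qed
  have rel: "1 / q k = (\<Sum>s=1..m. \<theta> s / p s k)" if k: "k \<in> {1..m}" for k
  proof -
    have "(\<Sum>s=1..m. \<theta> s / p s k) = (\<Sum>s=1..m. \<theta> s / 2 + (if s = k then \<theta> s / 2 else 0))"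
      by (intro sum.cong) (auto simp: p_def)
    also have "\<dots> = 1 / 2 + \<theta> k / 2"
      using k \<theta>1 by (simp add: sum.distrib flip: sum_divide_distrib)
    finally show ?thesis by (simp add: \<theta>_def field_simps)
  qed
  have le: "mixed_norm (p s) n c0_unit T [1..<Suc m] z \<le> C" if s: "s \<in> {1..m}" for s
  proof -
    have "mixed_norm (p s) n c0_unit T [1..<Suc m] z
        \<le> (\<Sum>i<n. slice_norm n c0_unit T (set [1..<Suc m] - {s}) (z(s := c0_unit i)))"
      using s by (intro mixed_norm_1_2_le) (auto simp: p_def)
    also have "set [1..<Suc m] - {s} = {1..m} - {s}" by auto
    also have "(\<Sum>i<n. slice_norm n c0_unit T ({1..m} - {s}) (z(s := c0_unit i)))
        \<le> (16 / 9) ^ card ({1..m} - {s}) * B"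
      using s z by (intro mixed_1_2_Littlewood_slices[where m = m] lin B) auto
    also have "card ({1..m} - {s}) = m - 1" using s by simp
    finally show ?thesis by (simp add: C_def)
  qed
  have "mixed_norm q n c0_unit T [1..<Suc m] z
      \<le> (\<Prod>s=1..m. mixed_norm (p s) n c0_unit T [1..<Suc m] z powr \<theta> s)"
    using \<theta> \<theta>1 rel q
    by (intro mixed_norm_interpolation) (auto simp: p_def intro: less_le_trans[of _ 1])
  also have "\<dots> \<le> (\<Prod>s=1..m. C powr \<theta> s)"
    using \<theta> le by (intro prod_mono) (auto intro!: powr_mono2 mixed_norm_nonneg)
  also have "\<dots> = C"
  proof (cases "C = 0")
    case True
    then have "(\<Prod>s=1..m. C powr \<theta> s) = 0"
      using m by (intro prod_zero) auto
    with True show ?thesis by simp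
  next
    case False
    then have "(\<Prod>s=1..m. C powr \<theta> s) = C powr (\<Sum>s=1..m. \<theta> s)"
      by (rule powr_sum[symmetric])
    also have "\<dots> = C" unfolding \<theta>1 using B0 by (simp add: C_def)
    finally show ?thesis .
  qed
  finally show ?thesis by (simp add: C_def)
qed

section \<open>The norm of a continuous multilinear form\<close>

lemma form_scale:
  assumes lin: "\<And>z k. z \<in> PiE {1..m} (\<lambda>_. UNIV) \<Longrightarrow> k \<in> {1..m} \<Longrightarrow> linear (\<lambda>x. T (z(k := x)))"
    and "finite L" "L \<subseteq> {1..m}" "z \<in> PiE {1..m} (\<lambda>_. UNIV)"
  shows "T (\<lambda>k. if k \<in> L then c *\<^sub>R z k else z k) = c ^ card L * T z"
  using assms(2-)
proof (induction L rule: finite_induct)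
  case (insert l L)
  define y where "y = (\<lambda>k. if k \<in> L then c *\<^sub>R z k else z k)"
  have "y \<in> PiE {1..m} (\<lambda>_. UNIV)"
    using insert.prems by (auto simp: y_def PiE_iff extensional_def)
  then interpret L: linear "\<lambda>x. T (y(l := x))"
    using insert.prems by (intro lin) auto
  have "(\<lambda>k. if k \<in> insert l L then c *\<^sub>R z k else z k) = y(l := c *\<^sub>R y l)"
    using insert.hyps by (auto simp: y_def)
  then have "T (\<lambda>k. if k \<in> insert l L then c *\<^sub>R z k else z k) = c * T y"
    using L.scaleR[of c "y l"] by simp
  also have "T y = c ^ card L * T z"
    unfolding y_def using insert by auto
  finally show ?case using insert.hyps by simp
qed simp

text \<open>\<open>form_norm\<close> is a supremum of reals, so it bounds the values of \<open>T\<close> only once these are known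
  to be bounded. As for linear maps, continuity at the origin gives a bound on a small polyball, and
  homogeneity in each variable extends it to the unit polyball.\<close>

lemma continuous_multilinear_form_bounded:
  assumes T: "continuous_multilinear_form m T" and m: "m \<ge> 1"
  shows "\<exists>B. \<forall>z\<in>unit_polyball m. \<bar>T z\<bar> \<le> B"
proof -
  let ?X = "product_topology (\<lambda>_. euclidean) {1..m} :: (nat \<Rightarrow> c0) topology"
  have lin: "linear (\<lambda>x. T (z(k := x)))" if "z \<in> PiE {1..m} (\<lambda>_. UNIV)" "k \<in> {1..m}" for z k
    using T that by (auto simp: continuous_multilinear_form_def)
  define o' where "o' = (\<lambda>k\<in>{1..m}. 0 :: c0)"
  have o': "o' \<in> PiE {1..m} (\<lambda>_. UNIV)" by (auto simp: o'_def)
  have "o'(1 := 0) = o'" using m by (auto simp: o'_def)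
  then have T0: "T o' = 0"
    using linear_0[OF lin[OF o', of 1]] m by simp
  have "openin ?X {z \<in> topspace ?X. T z \<in> {-1<..<1}}"
    using T by (intro openin_continuous_map_preimage) (auto simp: continuous_multilinear_form_def)
  moreover have "o' \<in> {z \<in> topspace ?X. T z \<in> {-1<..<1}}"
    using o' T0 by simp
  ultimately have "\<exists>U. finite {i \<in> {1..m}. U i \<noteq> topspace euclidean} \<and> (\<forall>i\<in>{1..m}. openin euclidean (U i)) \<and>
      o' \<in> PiE {1..m} U \<and> PiE {1..m} U \<subseteq> {z \<in> topspace ?X. T z \<in> {-1<..<1}}"
    unfolding openin_product_topology_alt by (rule bspec)
  then obtain U where U': "\<forall>i\<in>{1..m}. openin euclidean (U i)" and
    U: "o' \<in> PiE {1..m} U" "PiE {1..m} U \<subseteq> {z \<in> topspace ?X. T z \<in> {-1<..<1}}"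
    by (elim exE conjE)
  have "\<exists>r>0. ball 0 r \<subseteq> U i" if "i \<in> {1..m}" for i
  proof -
    have "0 \<in> U i" using U(1) that by (auto simp: PiE_iff o'_def)
    then show ?thesis using U' that open_contains_ball by (metis open_openin)
  qed
  then obtain r where r: "\<And>i. i \<in> {1..m} \<Longrightarrow> r i > 0 \<and> ball 0 (r i) \<subseteq> U i"
    by metis
  define \<delta> where "\<delta> = Min (r ` {1..m}) / 2"
  have \<delta>: "\<delta> > 0" using r m by (auto simp: \<delta>_def)
  have \<delta>_less: "\<delta> < r i" if i: "i \<in> {1..m}" for i
  proof -
    have "2 * \<delta> \<le> r i" using i by (auto simp: \<delta>_def)
    then show ?thesis using \<delta> by simp
  qed
  have "\<bar>T z\<bar> \<le> (1 / \<delta>) ^ m" if z: "z \<in> unit_polyball m" for z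
  proof -
    have zP: "z \<in> PiE {1..m} (\<lambda>_. UNIV)" and z1: "\<And>k. k \<in> {1..m} \<Longrightarrow> norm (z k) \<le> 1"
      using z by (auto simp: unit_polyball_def)
    define y where "y = (\<lambda>k. if k \<in> {1..m} then \<delta> *\<^sub>R z k else z k)"
    have "y k \<in> U k" if k: "k \<in> {1..m}" for k
    proof -
      have "norm (y k) \<le> \<delta> * 1"
        using k \<delta> z1[OF k] by (auto simp: y_def intro!: mult_left_mono)
      then show ?thesis using r[OF k] \<delta>_less[OF k] by (auto simp: subset_iff)
    qed
    moreover have "y \<in> extensional {1..m}"
      using zP by (auto simp: y_def PiE_iff extensional_def)
    ultimately have "y \<in> PiE {1..m} U" by (simp add: PiE_iff)
    then have "\<bar>T y\<bar> \<le> 1" using U(2) by auto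
    moreover have "T y = \<delta> ^ m * T z"
      using form_scale[OF lin finite_atLeastAtMost order_refl zP, of \<delta>] by (simp add: y_def)
    ultimately show ?thesis
      using \<delta> by (simp add: abs_mult field_simps)
  qed
  then show ?thesis by blast
qed

lemma form_norm_altdef: "form_norm m T = (SUP z\<in>unit_polyball m. \<bar>T z\<bar>)"
  unfolding form_norm_def unit_polyball_def by (intro arg_cong[of _ _ Sup]) auto

lemma abs_le_form_norm:
  assumes "continuous_multilinear_form m T" "m \<ge> 1" "z \<in> unit_polyball m"
  shows "\<bar>T z\<bar> \<le> form_norm m T"
proof -
  have "bdd_above ((\<lambda>z. \<bar>T z\<bar>) ` unit_polyball m)"
    using continuous_multilinear_form_bounded[OF assms(1,2)] by (auto simp: bdd_above_def)
  then show ?thesis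
    unfolding form_norm_altdef using assms(3) by (intro cSUP_upper)
qed

lemma units_in_unit_polyball: "(\<lambda>l\<in>{1..m}. c0_unit (j l)) \<in> unit_polyball m"
  by (auto simp: unit_polyball_def norm_c0_unit_le)

lemma form_norm_le:
  assumes "\<And>z. z \<in> unit_polyball m \<Longrightarrow> \<bar>T z\<bar> \<le> B"
  shows "form_norm m T \<le> B"
  unfolding form_norm_altdef using assms units_in_unit_polyball by (intro cSUP_least) auto

lemma form_norm_nonneg:
  assumes "continuous_multilinear_form m T" "m \<ge> 1"
  shows "form_norm m T \<ge> 0"
  using abs_le_form_norm[OF assms units_in_unit_polyball] abs_ge_zero order.trans by blast

text \<open>The exponents \<open>q k / q (k + 1)\<close> of the iterated sum combine a root \<open>1 / q (k + 1)\<close> of the inner sum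
  and a power \<open>q k\<close> in the outer one.\<close>

lemma nested_sum_eq_mixed_norm:
  assumes "k \<in> {1..m}" "\<And>l. l \<in> {1..m} \<Longrightarrow> q l > 0"
  shows "nested_sum m q n T k j powr (1 / q k)
    = mixed_norm q n c0_unit T [k..<Suc m] (\<lambda>l\<in>{1..m}. c0_unit (j l))"
  using assms(1)
proof (induction "m - k" arbitrary: k j)
  case 0
  then have k: "k = m" by simp
  have "(\<lambda>l\<in>{1..m}. c0_unit ((j(m := i)) l)) = (\<lambda>l\<in>{1..m}. c0_unit (j l))(m := c0_unit i)" for i
    using 0 by (auto simp: k)
  then show ?case
    unfolding k by (subst nested_sum.simps) simp
next
  case (Suc d)
  then have k: "k < m" by simp
  have qS: "q (Suc k) > 0" using assms(2) k by simp
  have upd: "(\<lambda>l\<in>{1..m}. c0_unit ((j(k := i)) l)) = (\<lambda>l\<in>{1..m}. c0_unit (j l))(k := c0_unit i)" for i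
    using Suc.prems by auto
  have IH: "nested_sum m q n T (Suc k) (j(k := i)) powr (q k / q (Suc k))
    = mixed_norm q n c0_unit T [Suc k..<Suc m] ((\<lambda>l\<in>{1..m}. c0_unit (j l))(k := c0_unit i)) powr q k" for i
  proof -
    have "nested_sum m q n T (Suc k) (j(k := i)) powr (1 / q (Suc k))
      = mixed_norm q n c0_unit T [Suc k..<Suc m] ((\<lambda>l\<in>{1..m}. c0_unit (j l))(k := c0_unit i))"
      using Suc.hyps(1)[of "Suc k" "j(k := i)"] Suc.hyps(2) k
      unfolding upd by (simp del: upt_Suc fun_upd_apply)
    then show ?thesis by (metis powr_powr times_divide_eq_left mult_1)
  qed
  show ?case
    using k by (subst nested_sum.simps) (simp add: IH upt_conv_Cons del: upt_Suc fun_upd_apply)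
qed

lemma mixed_sum_eq_mixed_norm:
  assumes "m \<ge> 1" "\<And>l. l \<in> {1..m} \<Longrightarrow> q l > 0"
  shows "mixed_sum m q n T = mixed_norm q n c0_unit T [1..<Suc m] (\<lambda>l\<in>{1..m}. c0_unit 0)"
  unfolding mixed_sum_def using assms by (intro nested_sum_eq_mixed_norm) auto

section \<open>An extremal form on a binary tree\<close>

text \<open>The base variable \<open>b\<close> is indexed by the leaves below node \<open>p\<close> of a binary tree with children
  \<open>2 * p\<close> and \<open>2 * p + 1\<close>. The other variables belong to the levels of the tree, and at each node the
  \<open>2 \<times> 2\<close> sign matrix with rows \<open>(1, 1)\<close> and \<open>(1, -1)\<close> couples the two coordinates of the level
  variable with the two subtrees. For one level this is Littlewood's bilinear form
  \<open>(x\<^sub>0 + x\<^sub>1) y\<^sub>0 + (x\<^sub>0 - x\<^sub>1) y\<^sub>1\<close>.\<close>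

fun dyadic_form :: "nat list \<Rightarrow> nat \<Rightarrow> nat \<Rightarrow> (nat \<Rightarrow> c0) \<Rightarrow> real" where
  "dyadic_form [] b p z = c0_nth (z b) p"
| "dyadic_form (v # vs) b p z =
     (c0_nth (z v) (2 * p) + c0_nth (z v) (2 * p + 1)) * dyadic_form vs b (2 * p) z
   + (c0_nth (z v) (2 * p) - c0_nth (z v) (2 * p + 1)) * dyadic_form vs b (2 * p + 1) z"

text \<open>Each level costs only a factor 2, because \<open>\<bar>s + t\<bar> + \<bar>s - t\<bar> \<le> 2\<close> for real
  \<open>s, t \<in> [-1, 1]\<close>.\<close>

lemma dyadic_form_bound:
  assumes "\<And>k. k \<in> set (b # vs) \<Longrightarrow> norm (z k) \<le> 1"
  shows "\<bar>dyadic_form vs b p z\<bar> \<le> 2 ^ length vs"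
  using assms
proof (induction vs arbitrary: p)
  case Nil
  then show ?case using order.trans[OF c0_nth_le_norm] by simp
next
  case (Cons v vs)
  define s t where "s = c0_nth (z v) (2 * p)" and "t = c0_nth (z v) (2 * p + 1)"
  define A B where "A = dyadic_form vs b (2 * p) z" and "B = dyadic_form vs b (2 * p + 1) z"
  have st: "\<bar>s\<bar> \<le> 1" "\<bar>t\<bar> \<le> 1"
    using Cons.prems[of v] c0_nth_le_norm order.trans unfolding s_def t_def by fastforce+
  have AB: "\<bar>A\<bar> \<le> 2 ^ length vs" "\<bar>B\<bar> \<le> 2 ^ length vs"
    using Cons by (auto simp: A_def B_def)
  have "\<bar>(s + t) * A + (s - t) * B\<bar> \<le> \<bar>s + t\<bar> * \<bar>A\<bar> + \<bar>s - t\<bar> * \<bar>B\<bar>"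
    by (metis abs_mult abs_triangle_ineq)
  also have "\<dots> \<le> \<bar>s + t\<bar> * 2 ^ length vs + \<bar>s - t\<bar> * 2 ^ length vs"
    using AB by (intro add_mono mult_left_mono) auto
  also have "\<dots> = (\<bar>s + t\<bar> + \<bar>s - t\<bar>) * 2 ^ length vs"
    by (simp add: algebra_simps)
  also have "\<dots> \<le> 2 * 2 ^ length vs"
    using st by (intro mult_right_mono) auto
  finally show ?case by (simp add: s_def t_def A_def B_def)
qed

lemma linear_c0_nth: "linear (\<lambda>x. c0_nth x i)"
  by (rule linearI) auto

lemma bounded_linear_c0_nth: "bounded_linear (\<lambda>x. c0_nth x i)"
  by (rule bounded_linear_intro[where K = 1]) (auto simp: c0_nth_le_norm)

lemma dyadic_form_continuous:
  assumes "set (b # vs) \<subseteq> I"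
  shows "continuous_map (product_topology (\<lambda>_. euclidean) I) euclideanreal (dyadic_form vs b p)"
proof -
  have coord: "continuous_map (product_topology (\<lambda>_. euclidean) I) euclideanreal (\<lambda>z. c0_nth (z k) i)"
    if "k \<in> I" for k i
  proof -
    have "continuous_map euclidean euclideanreal (\<lambda>x. c0_nth x i)"
      using linear_continuous_on[OF bounded_linear_c0_nth] by simp
    from continuous_map_compose[OF continuous_map_product_projection[OF that] this]
    show ?thesis by (simp add: o_def)
  qed
  show ?thesis
    using assms
  proof (induction vs arbitrary: p)
    case Nil
    then show ?case using coord by simp
  next
    case (Cons v vs)
    then show ?case
      using coord by (auto intro!: continuous_intros)
  qed
qed

lemma dyadic_form_upd_other:
  "k \<notin> set (b # vs) \<Longrightarrow> dyadic_form vs b p (z(k := x)) = dyadic_form vs b p z"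
  by (induction vs arbitrary: p) auto

lemma dyadic_form_linear:
  assumes "distinct (b # vs)" "k \<in> set (b # vs)"
  shows "linear (\<lambda>x. dyadic_form vs b p (z(k := x)))"
  using assms
proof (induction vs arbitrary: p)
  case Nil
  then show ?case using linear_c0_nth by simp
next
  case (Cons v vs)
  show ?case
  proof (cases "k = v")
    case True
    then have "dyadic_form vs b p' (z(k := x)) = dyadic_form vs b p' z" for p' x
      using Cons.prems by (intro dyadic_form_upd_other) auto
    then have "(\<lambda>x. dyadic_form (v # vs) b p (z(k := x))) = (\<lambda>x.
        (c0_nth x (2 * p) + c0_nth x (2 * p + 1)) * dyadic_form vs b (2 * p) z
      + (c0_nth x (2 * p) - c0_nth x (2 * p + 1)) * dyadic_form vs b (2 * p + 1) z)"
      by (simp only: dyadic_form.simps) (simp add: True)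
    moreover have "linear (\<lambda>x.
        (c0_nth x (2 * p) + c0_nth x (2 * p + 1)) * dyadic_form vs b (2 * p) z
      + (c0_nth x (2 * p) - c0_nth x (2 * p + 1)) * dyadic_form vs b (2 * p + 1) z)"
      by (intro linearI) (simp_all add: algebra_simps)
    ultimately show ?thesis by (simp only:)
  next
    case False
    then have IH: "linear (\<lambda>x. dyadic_form vs b p (z(k := x)))" for p
      using Cons.prems False by (intro Cons.IH) auto
    have comb: "linear (\<lambda>x. s * f x + t * g x)"
      if "linear f" "linear g" for s t :: real and f g :: "c0 \<Rightarrow> real"
      using that by (intro linearI) (simp_all add: linear_add linear_scale algebra_simps)
    show ?thesis
      using False comb[OF IH IH] by (simp only: dyadic_form.simps fun_upd_other not_False_eq_True)
  qed
qed

text \<open>A leaf \<open>j\<close> is seen only from its ancestors, and \<open>j div 2^l\<close> is the ancestor \<open>l\<close> levels up.\<close>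

lemma dyadic_form_units_eq_0:
  assumes "z b = c0_unit j" "j div 2 ^ length vs \<noteq> p"
  shows "dyadic_form vs b p z = 0"
  using assms
proof (induction vs arbitrary: p)
  case Nil
  then show ?case by (simp add: c0_nth_unit)
next
  case (Cons v vs)
  have "j div 2 ^ length vs div 2 \<noteq> p"
    using Cons.prems by (simp add: div_mult2_eq[symmetric] mult.commute)
  then have "j div 2 ^ length vs \<noteq> 2 * p" "j div 2 ^ length vs \<noteq> 2 * p + 1"
    by auto
  then show ?case using Cons by simp
qed

text \<open>Along the path from a leaf to the root, exactly one of the two subtrees contributes at each node,
  and a level variable is compatible with the leaf if its index is one of the two coordinates
  attached to the node on that path. Compatible unit vectors give a coefficient \<open>\<plusminus>1\<close>.\<close>

lemma dyadic_form_units_abs_1: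
  assumes "\<And>k. k \<in> set (b # vs) \<Longrightarrow> z k = c0_unit (j k)"
    and "\<And>t. t < length vs \<Longrightarrow> j (vs ! t) div 2 = j b div 2 ^ (length vs - t)"
  shows "\<bar>dyadic_form vs b (j b div 2 ^ length vs) z\<bar> = 1"
  using assms
proof (induction vs)
  case Nil
  then show ?case by (simp add: c0_nth_unit)
next
  case (Cons v vs)
  define c p where "c = j b div 2 ^ length vs" and "p = j b div 2 ^ length (v # vs)"
  have IH: "\<bar>dyadic_form vs b c z\<bar> = 1"
    unfolding c_def
  proof (rule Cons.IH)
    show "j (vs ! t) div 2 = j b div 2 ^ (length vs - t)" if "t < length vs" for t
      using Cons.prems(2)[of "Suc t"] that by simp
  qed (use Cons.prems in auto)
  have zv: "z v = c0_unit (j v)" and zb: "z b = c0_unit (j b)"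
    using Cons.prems by auto
  have "j v div 2 = p" using Cons.prems(2)[of 0] by (simp add: p_def)
  then have jv: "j v = 2 * p \<or> j v = 2 * p + 1" by linarith
  then have signs: "\<bar>c0_nth (z v) (2 * p) + c0_nth (z v) (2 * p + 1)\<bar> = 1"
    "\<bar>c0_nth (z v) (2 * p) - c0_nth (z v) (2 * p + 1)\<bar> = 1"
    unfolding zv c0_nth_unit by auto
  have "c div 2 = p"
    by (simp add: c_def p_def div_mult2_eq[symmetric] mult.commute)
  then consider "c = 2 * p" | "c = 2 * p + 1" by linarith
  then have "\<bar>dyadic_form (v # vs) b p z\<bar> = 1"
  proof cases
    case 1
    have "dyadic_form vs b (2 * p + 1) z = 0"
      using zb 1 by (intro dyadic_form_units_eq_0[where j = "j b"]) (simp_all flip: c_def)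
    then show ?thesis using signs(1) IH[unfolded 1] by (simp add: abs_mult)
  next
    case 2
    have "dyadic_form vs b (2 * p) z = 0"
      using zb 2 by (intro dyadic_form_units_eq_0[where j = "j b"]) (simp_all flip: c_def)
    then show ?thesis using signs(2) IH[unfolded 2] by (simp add: abs_mult)
  qed
  then show ?case by (simp add: p_def)
qed

section \<open>The lower bound\<close>

text \<open>The first variable is put at the root of the tree, the second one at the leaves, and the variables
  \<open>3, \<dots>, m\<close> at the levels in between. This order is what makes the iterated sum easy: once the
  leaf \<open>j 2\<close> has been chosen, each later variable has exactly two compatible values, whatever the
  others are. So each later summation contributes a factor \<open>2 powr (1 / q l)\<close>.\<close>

lemma dyadic_form_mixed_norm_tail:
  assumes m: "m \<ge> 2" and q: "\<And>k. k \<in> {1..m} \<Longrightarrow> q k > 0"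
    and "3 \<le> k" "k \<le> Suc m"
    and "\<And>l. l \<in> {1..<k} \<Longrightarrow> z l = c0_unit (j l)"
    and "j 1 < 2" "j 2 < 2 ^ (m - 1)"
    and "\<And>l. l \<in> {3..<k} \<Longrightarrow> j l div 2 = j 2 div 2 ^ (Suc m - l)"
  shows "2 powr (\<Sum>l=k..m. 1 / q l)
    \<le> mixed_norm q (2 ^ (m - 1)) c0_unit (dyadic_form (1 # [3..<Suc m]) 2 0) [k..<Suc m] z"
  using assms(3-)
proof (induction "Suc m - k" arbitrary: k z j)
  case 0
  then have k: "k = Suc m" by simp
  let ?vs = "1 # [3..<Suc m]"
  have len: "length ?vs = m - 1"
    using m by (simp only: length_Cons length_upt)
  have "\<bar>dyadic_form ?vs 2 (j 2 div 2 ^ length ?vs) z\<bar> = 1"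
  proof (rule dyadic_form_units_abs_1)
    show "z l = c0_unit (j l)" if "l \<in> set (2 # ?vs)" for l
      using 0(4)[of l] that m by (auto simp: k)
    show "j (?vs ! t) div 2 = j 2 div 2 ^ (length ?vs - t)" if t: "t < length ?vs" for t
    proof (cases t)
      case 0
      then show ?thesis using \<open>j 1 < 2\<close> \<open>j 2 < 2 ^ (m - 1)\<close> len by simp
    next
      case (Suc t')
      then have "?vs ! t = t' + 3" "t' + 3 < Suc m"
        using t len by (auto simp del: upt_Suc)
      moreover have "length ?vs - t = Suc m - (t' + 3)"
        using Suc len by simp
      ultimately show ?thesis
        using 0(7)[of "t' + 3"] by (simp add: k)
    qed
  qed
  moreover have "j 2 div 2 ^ length ?vs = 0"
    using \<open>j 2 < 2 ^ (m - 1)\<close> len by simp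
  ultimately show ?case by (simp add: k)
next
  case (Suc d)
  then have k: "k \<le> m" "3 \<le> k" by auto
  \<comment> \<open>The node on the path to the leaf \<open>j 2\<close> at the level of variable \<open>k\<close>; its two coordinates are the compatible values.\<close>
  define c where "c = j 2 div 2 ^ (Suc m - k)"
  have "(2::nat) ^ (m - 1) = 2 ^ (k - 2) * 2 ^ (Suc m - k)"
    using k by (simp flip: power_add)
  then have "c < 2 ^ (k - 2)"
    unfolding c_def using Suc.prems by (intro less_mult_imp_div_less) simp
  then have "2 * c + 2 \<le> 2 * 2 ^ (k - 2)" by linarith
  also have "(2::nat) * 2 ^ (k - 2) = 2 ^ (k - 1)"
    using k by (simp flip: power_Suc)
  also have "(2::nat) ^ (k - 1) \<le> 2 ^ (m - 1)"
    using k by (intro power_increasing) auto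
  finally have I: "{2 * c, 2 * c + 1} \<subseteq> {..<2 ^ (m - 1)}" by auto
  have "2 powr (\<Sum>l=k..m. 1 / q l) = real (card {2 * c, 2 * c + 1}) powr (1 / q k)
      * 2 powr (\<Sum>l=Suc k..m. 1 / q l)"
    using k by (simp add: sum.atLeast_Suc_atMost powr_add)
  also have "\<dots> \<le> mixed_norm q (2 ^ (m - 1)) c0_unit (dyadic_form (1 # [3..<Suc m]) 2 0)
      (k # [Suc k..<Suc m]) z"
  proof (rule mixed_norm_Cons_ge[OF I])
    fix i assume i: "i \<in> {2 * c, 2 * c + 1}"
    show "2 powr (\<Sum>l=Suc k..m. 1 / q l) \<le> mixed_norm q (2 ^ (m - 1)) c0_unit
        (dyadic_form (1 # [3..<Suc m]) 2 0) [Suc k..<Suc m] (z(k := c0_unit i))"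
    proof (rule Suc.hyps(1)[where j = "j(k := i)"])
      show "(j(k := i)) l div 2 = (j(k := i)) 2 div 2 ^ (Suc m - l)" if "l \<in> {3..<Suc k}" for l
      proof (cases "l = k")
        case True
        then show ?thesis using i k by (auto simp: c_def[symmetric])
      next
        case False
        then show ?thesis using Suc.prems(6)[of l] that k by auto
      qed
      show "(z(k := c0_unit i)) l = c0_unit ((j(k := i)) l)" if "l \<in> {1..<Suc k}" for l
        using Suc.prems(3)[of l] that by auto
    qed (use k Suc.hyps(2) Suc.prems in auto)
  qed (use q k in auto)
  also have "k # [Suc k..<Suc m] = [k..<Suc m]"
    using k by (simp add: upt_conv_Cons)
  finally show ?case .
qed

text \<open>The two outer summations range over the two coordinates at the root and over all
  \<open>2 ^ (m - 1)\<close> leaves.\<close>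

lemma dyadic_form_mixed_norm_ge:
  assumes m: "m \<ge> 2" and q: "\<And>k. k \<in> {1..m} \<Longrightarrow> q k > 0"
  shows "2 powr (1 / q 1 + (real (m - 1) / q 2 + (\<Sum>l=3..m. 1 / q l)))
    \<le> mixed_norm q (2 ^ (m - 1)) c0_unit (dyadic_form (1 # [3..<Suc m]) 2 0) [1..<Suc m] z"
proof -
  let ?M = "mixed_norm q (2 ^ (m - 1)) c0_unit (dyadic_form (1 # [3..<Suc m]) 2 0)"
  have two: "(2::nat) ^ 1 \<le> 2 ^ (m - 1)"
    using m by (intro power_increasing) auto
  have tail: "2 powr (\<Sum>l=3..m. 1 / q l) \<le> ?M [3..<Suc m] (z(1 := c0_unit i1, 2 := c0_unit i2))"
    if "i1 < 2" "i2 < 2 ^ (m - 1)" for i1 i2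
    using that m
    by (intro dyadic_form_mixed_norm_tail[where j = "(\<lambda>_. 0)(1 := i1, 2 := i2)"] q) auto
  have second: "2 powr (real (m - 1) / q 2 + (\<Sum>l=3..m. 1 / q l)) \<le> ?M (2 # [3..<Suc m]) (z(1 := c0_unit i1))"
    if i1: "i1 < 2" for i1
  proof -
    have "2 powr (real (m - 1) / q 2 + (\<Sum>l=3..m. 1 / q l))
        = real (card {..<2 ^ (m - 1) :: nat}) powr (1 / q 2) * 2 powr (\<Sum>l=3..m. 1 / q l)"
      by (simp add: powr_add powr_powr flip: powr_realpow)
    also have "\<dots> \<le> ?M (2 # [3..<Suc m]) (z(1 := c0_unit i1))"
    proof (rule mixed_norm_Cons_ge)
      fix i :: nat assume "i \<in> {..<2 ^ (m - 1)}"
      then show "2 powr (\<Sum>l=3..m. 1 / q l) \<le> ?M [3..<Suc m] (z(1 := c0_unit i1, 2 := c0_unit i))"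
        by (intro tail i1) simp
    qed (use q m in auto)
    finally show ?thesis .
  qed
  have "2 powr (1 / q 1 + (real (m - 1) / q 2 + (\<Sum>l=3..m. 1 / q l)))
      = real (card {..<2 :: nat}) powr (1 / q 1) * 2 powr (real (m - 1) / q 2 + (\<Sum>l=3..m. 1 / q l))"
    by (simp add: powr_add)
  also have "\<dots> \<le> ?M (1 # 2 # [3..<Suc m]) z"
  proof (rule mixed_norm_Cons_ge)
    fix i :: nat assume "i \<in> {..<2}"
    then show "2 powr (real (m - 1) / q 2 + (\<Sum>l=3..m. 1 / q l)) \<le> ?M (2 # [3..<Suc m]) (z(1 := c0_unit i))"
      by (intro second) simp
  qed (use q m two in auto)
  also have "1 # 2 # [3..<Suc m] = [1..<Suc m]"
    using m by (simp add: upt_conv_Cons numeral_eq_Suc)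
  finally show ?thesis .
qed

lemma dyadic_form_continuous_multilinear:
  assumes "m \<ge> 2"
  shows "continuous_multilinear_form m (dyadic_form (1 # [3..<Suc m]) 2 0)"
proof -
  have vars: "set (2 # 1 # [3..<Suc m]) = {1..m}" using assms by auto
  have "linear (\<lambda>x. dyadic_form (1 # [3..<Suc m]) 2 0 (z(k := x)))" if "k \<in> {1..m}" for z k
    using that vars by (intro dyadic_form_linear) (simp, blast)
  moreover have "continuous_map (product_topology (\<lambda>_. euclidean) {1..m}) euclideanreal
      (dyadic_form (1 # [3..<Suc m]) 2 0)"
    using vars by (intro dyadic_form_continuous) simp
  ultimately show ?thesis by (simp only: continuous_multilinear_form_def) blast
qed

lemma form_norm_dyadic_form_le:
  assumes "m \<ge> 2"
  shows "form_norm m (dyadic_form (1 # [3..<Suc m]) 2 0) \<le> 2 ^ (m - 1)"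
proof (rule form_norm_le)
  fix z :: "nat \<Rightarrow> c0" assume "z \<in> unit_polyball m"
  then have "\<bar>dyadic_form (1 # [3..<Suc m]) 2 0 z\<bar> \<le> 2 ^ length (1 # [3..<Suc m])"
    using assms by (intro dyadic_form_bound) (auto simp: unit_polyball_def)
  also have "length (1 # [3..<Suc m]) = m - 1"
    using assms by (simp only: length_Cons length_upt)
  finally show "\<bar>dyadic_form (1 # [3..<Suc m]) 2 0 z\<bar> \<le> 2 ^ (m - 1)" .
qed

lemma admissible_constant_ge:
  assumes m: "m \<ge> 2" and q: "\<And>k. k \<in> {1..m} \<Longrightarrow> q k > 0"
    and C: "admissible_constant m q C"
  shows "2 powr (1 / q 1 + (real (m - 1) / q 2 + (\<Sum>l=3..m. 1 / q l)) - real (m - 1)) \<le> C"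
proof -
  let ?T = "dyadic_form (1 # [3..<Suc m]) 2 0"
  let ?E = "1 / q 1 + (real (m - 1) / q 2 + (\<Sum>l=3..m. 1 / q l))"
  have m1: "m \<ge> 1" using m by simp
  have T: "continuous_multilinear_form m ?T"
    by (rule dyadic_form_continuous_multilinear[OF m])
  have "2 powr ?E \<le> mixed_norm q (2 ^ (m - 1)) c0_unit ?T [1..<Suc m] (\<lambda>l\<in>{1..m}. c0_unit 0)"
    by (rule dyadic_form_mixed_norm_ge) (fact m, fact q)
  also have "\<dots> = mixed_sum m q (2 ^ (m - 1)) ?T"
    by (rule mixed_sum_eq_mixed_norm[symmetric]) (fact m1, fact q)
  also have "\<dots> \<le> C * form_norm m ?T"
    using C T by (simp add: admissible_constant_def)
  finally have le: "2 powr ?E \<le> C * form_norm m ?T" .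
  have N0: "form_norm m ?T \<ge> 0" using T m by (intro form_norm_nonneg) auto
  have "0 < 2 powr ?E" by simp
  with le have "0 < C * form_norm m ?T" by linarith
  then have "C \<ge> 0" using N0 by (simp add: zero_less_mult_iff)
  then have "C * form_norm m ?T \<le> C * 2 ^ (m - 1)"
    by (intro mult_left_mono form_norm_dyadic_form_le m)
  with le have "2 powr ?E \<le> C * 2 ^ (m - 1)" by linarith
  then show ?thesis
    by (simp only: powr_diff) (simp add: powr_realpow field_simps)
qed

section \<open>The optimal constant\<close>

lemma admissible_constant_exists:
  assumes m: "m \<ge> 1" and q: "\<And>k. k \<in> {1..m} \<Longrightarrow> q k \<in> {1..2}"
    and sum_q: "(\<Sum>k=1..m. 1 / q k) = (real m + 1) / 2"
  shows "admissible_constant m q ((16 / 9) ^ (m - 1))"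
  unfolding admissible_constant_def
proof (intro allI impI)
  fix T n
  assume T: "continuous_multilinear_form m T"
  have q0: "q l > 0" if "l \<in> {1..m}" for l
    using q[OF that] by simp
  have "mixed_sum m q n T = mixed_norm q n c0_unit T [1..<Suc m] (\<lambda>l\<in>{1..m}. c0_unit 0)"
    by (rule mixed_sum_eq_mixed_norm) (fact m, fact q0)
  also have "\<dots> \<le> (16 / 9) ^ (m - 1) * form_norm m T"
  proof (rule anisotropic_Bohnenblust_Hille)
    show "linear (\<lambda>x. T (z(k := x)))" if "z \<in> PiE {1..m} (\<lambda>_. UNIV)" "k \<in> {1..m}" for z k
      using T that by (auto simp: continuous_multilinear_form_def)
    show "\<bar>T z\<bar> \<le> form_norm m T" if "z \<in> unit_polyball m" for z
      by (rule abs_le_form_norm[OF T m that])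
  qed (fact m, fact q, fact sum_q, rule units_in_unit_polyball)
  finally show "mixed_sum m q n T \<le> (16 / 9) ^ (m - 1) * form_norm m T" .
qed

text \<open>A least element of a set of reals has to be shown to exist. The set of admissible constants is
  defined by non-strict inequalities that are linear in \<open>C\<close>, so it contains its infimum. A lower bound
  \<open>b\<close> makes the infimum meaningful: it excludes the degenerate case in which every real is admissible.\<close>

lemma optimal_constant_least:
  assumes m: "m \<ge> 1" and C: "admissible_constant m q C"
    and lower: "\<And>C. admissible_constant m q C \<Longrightarrow> b \<le> C"
  shows "admissible_constant m q (optimal_constant m q)"
    and "admissible_constant m q D \<Longrightarrow> optimal_constant m q \<le> D"
proof -
  define A where "A = {C. admissible_constant m q C}"
  have A: "A \<noteq> {}" "bdd_below A"
    using C lower by (auto simp: A_def bdd_below_def)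
  have "admissible_constant m q (Inf A)"
    unfolding admissible_constant_def
  proof (intro allI impI)
    fix T and n :: nat
    assume T: "continuous_multilinear_form m T" and n: "n \<ge> 1"
    have le: "mixed_sum m q n T \<le> D * form_norm m T" if "D \<in> A" for D
      using that T n by (auto simp: A_def admissible_constant_def)
    show "mixed_sum m q n T \<le> Inf A * form_norm m T"
    proof (cases "form_norm m T = 0")
      case True
      then show ?thesis using le[of C] C by (simp add: A_def)
    next
      case False
      then have pos: "form_norm m T > 0"
        using form_norm_nonneg[OF T m] by simp
      have "mixed_sum m q n T / form_norm m T \<le> Inf A"
        using A(1) le pos by (intro cInf_greatest) (auto simp: divide_le_eq)
      then show ?thesis using pos by (simp add: divide_le_eq)
    qed
  qed
  moreover have "Inf A \<le> D" if "admissible_constant m q D" for D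
    using that A by (intro cInf_lower) (auto simp: A_def)
  ultimately have "optimal_constant m q = Inf A"
    unfolding optimal_constant_def by (intro Least_equality)
  with \<open>admissible_constant m q (Inf A)\<close> \<open>\<And>D. admissible_constant m q D \<Longrightarrow> Inf A \<le> D\<close>
  show "admissible_constant m q (optimal_constant m q)"
    and "admissible_constant m q D \<Longrightarrow> optimal_constant m q \<le> D"
    by auto
qed

text \<open>After division by \<open>q 1 \<cdot> \<dots> \<cdot> q m\<close>, each \<open>q_hat m q i\<close> becomes \<open>1 / q i\<close>, and the exponent is the one
  obtained from the extremal form.\<close>

theorem theorem3p1:
  fixes m :: nat and q :: "nat \<Rightarrow> real"
  assumes "m \<ge> 2"
    and "\<And>k. k \<in> {1..m} \<Longrightarrow> q k \<in> {1..2}"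
    and "(\<Sum>k=1..m. 1 / q k) = (real m + 1) / 2"
  shows "(\<exists>C. admissible_constant m q C) \<and>
    admissible_constant m q (optimal_constant m q) \<and>
    (\<forall>C. admissible_constant m q C \<longrightarrow> optimal_constant m q \<le> C) \<and>
    optimal_constant m q \<ge>
      2 powr (((real m - 1) * q_hat m q 2 + (\<Sum>i\<in>{1..m} - {2}. q_hat m q i)
                 - (real m - 1) * (\<Prod>k=1..m. q k)) / (\<Prod>k=1..m. q k))"
proof -
  have m1: "m \<ge> 1" using assms(1) by simp
  have q0: "q k > 0" if "k \<in> {1..m}" for k
    using assms(2)[OF that] by simp
  have exists: "admissible_constant m q ((16 / 9) ^ (m - 1))"
    by (rule admissible_constant_exists[OF m1 assms(2,3)])
  have lower: "2 powr (1 / q 1 + (real (m - 1) / q 2 + (\<Sum>l=3..m. 1 / q l)) - real (m - 1)) \<le> C"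
    if "admissible_constant m q C" for C
    by (rule admissible_constant_ge) (fact assms(1), fact q0, fact that)
  note optimal = optimal_constant_least[OF m1 exists lower]
  define P where "P = (\<Prod>k=1..m. q k)"
  have P: "P > 0" unfolding P_def using q0 by (intro prod_pos) auto
  have q_hat: "q_hat m q i / P = 1 / q i" for i
    unfolding q_hat_def P_def[symmetric] using P by simp
  have "{1..m} - {2} = insert 1 {3..m}" using assms(1) by auto
  then have "(\<Sum>i\<in>{1..m} - {2}. q_hat m q i) / P = 1 / q 1 + (\<Sum>l=3..m. 1 / q l)"
    by (simp only: sum_divide_distrib q_hat) simp
  moreover note q_hat[of 2]
  moreover have "((real m - 1) * q_hat m q 2 + (\<Sum>i\<in>{1..m} - {2}. q_hat m q i) - (real m - 1) * P) / P
      = (real m - 1) * (q_hat m q 2 / P) + (\<Sum>i\<in>{1..m} - {2}. q_hat m q i) / P - (real m - 1)"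
    using P by (simp add: add_divide_distrib diff_divide_distrib)
  ultimately have "((real m - 1) * q_hat m q 2 + (\<Sum>i\<in>{1..m} - {2}. q_hat m q i)
      - (real m - 1) * P) / P
      = 1 / q 1 + (real (m - 1) / q 2 + (\<Sum>l=3..m. 1 / q l)) - real (m - 1)"
    using m1 by (simp add: of_nat_diff)
  then show ?thesis
    using exists optimal lower[OF optimal(1)] unfolding P_def by auto
qed

end
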